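(* Let $\mathrm{P}_{\boldsymbol\theta}$ be the binary pairwise Markov network on $\{0,1\}^p$ with parameter $\boldsymbol\theta\in\mathbb{R}^m$. Let $\tilde{\mathbf x}_\tau$ be the sample generated after running Gibbs sampling for $\tau$ steps (Gibbs-$\tau$) under the parameterization $\boldsymbol\theta$, initialized at $\tilde{\mathbf x}_0\in\{0,1\}^p$. Let $m$ be the number of sufficient statistics and let $\mathbf B$ be the $p\times p$ matrix computed from $\boldsymbol\theta$ as in the context. Then $$\left\lVert \mathbb{E}_{\tilde{\mathbf x}_\tau}[\boldsymbol\delta(\boldsymbol\theta)\mid \tilde{\mathbf x}_0]\right\rVert_2\le 2\sqrt{m}\,\mathscr{G}(\mathbf B^\tau),$$ where $\mathbf B^\tau$ is the $\tau$-th power of $\mathbf B$.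
   Context: Binary pairwise Markov network: for $\mathbf x\in\{0,1\}^p$ and $\boldsymbol\theta=(\theta_{ij})_{1\le i\le j\le p}$, $$\mathrm{P}_{\boldsymbol\theta}(\mathbf x)=\frac{1}{Z(\boldsymbol\theta)}\exp\Big(\sum_{i=1}^p\sum_{j\ge i}\theta_{ij}x_ix_j\Big),$$ with $Z(\boldsymbol\theta)$ the normalizing constant. The sufficient statistics are $\boldsymbol\psi(\mathbf x)=(x_ix_j)_{i\le j}\in\{0,1\}^m$, where $m$ is the dimension of $\boldsymbol\theta$. $\mathbb{E}_{\boldsymbol\theta}\boldsymbol\psi=\sum_{\mathbf x}\mathrm{P}_{\boldsymbol\theta}(\mathbf x)\boldsymbol\psi(\mathbf x)$. Gibbs sampling: one step (Gibbs-1) takes a current state $\mathbf x\in\{0,1\}^p$ and, for $i=1,2,\dots,p$ in this order, replaces $x_i$ by a fresh draw from the conditional distribution $\mathrm{P}_{\boldsymbol\theta}(X_i\mid \mathbf x_{-i})$ given the current values of the other coordinates. Gibbs-$\tau$ applies Gibbs-1 $\tau$ times. Gradient approximation error: for a data set $\mathbb{X}$ of $n$ points, $f(\boldsymbol\theta)=-\frac1n\sum_{\mathbf x\in\mathbb X}\boldsymbol\theta^\top\boldsymbol\psi(\mathbf x)+\log Z(\boldsymbol\theta)$, with gradient $\nabla f(\boldsymbol\theta)=\mathbb{E}_{\boldsymbol\theta}\boldsymbol\psi-\frac1n\sum_{\mathbf x\in\mathbb X}\boldsymbol\psi(\mathbf x)$. The approximate gradient based on the single sample $\tilde{\mathbf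 x}_\tau$ is $\boldsymbol\Delta f(\boldsymbol\theta)=\boldsymbol\psi(\tilde{\mathbf x}_\tau)-\frac1n\sum_{\mathbf x\in\mathbb X}\boldsymbol\psi(\mathbf x)$, and $\boldsymbol\delta(\boldsymbol\theta)=\boldsymbol\Delta f(\boldsymbol\theta)-\nabla f(\boldsymbol\theta)=\boldsymbol\psi(\tilde{\mathbf x}_\tau)-\mathbb{E}_{\boldsymbol\theta}\boldsymbol\psi$. $\mathbb{E}_{\tilde{\mathbf x}_\tau}[\cdot\mid\tilde{\mathbf x}_0]$ is expectation over the randomness of the chain started at $\tilde{\mathbf x}_0$. Matrix $\mathbf B$: put $\xi_{ij}=\theta_{\min\{i,j\},\max\{i,j\}}$ and let $\mathbf U$ be the $p\times p$ matrix with $$U_{ij}=\frac{|\exp(-\xi_{ij})-1|\,b^*}{(1+b^*\exp(-\xi_{ij}))(1+b^* )},\qquad b^*=\max\{r,\min\{s,\exp(\xi_{ij}/2)\}\},$$ $$s=\exp\Big(-\xi_{ii}-\sum_{k\ne i,\,k\ne j}\xi_{ik}\max\{-\mathrm{sgn}(\xi_{ik}),0\}\Big),\quad r=\exp\Big(-\xi_{ii}-\sum_{k\ne i,\,k\ne j}\xi_{ik}\max\{\mathrm{sgn}(\xi_{ik}),0\}\Big)$$ (so $r,s,b^*$ depend on $i,j$). Let $\mathbf B_i$ be the $p\times p$ identity matrix with its $i$-th row replaced by the $i$-th row of $\mathbf U$, and $\mathbf B=\mathbf B_p\mathbf B_{p-1}\cdots\mathbf B_1$. For a $p\times p$ matrix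 $\mathbf M$, $\mathscr G(\mathbf M)=\sum_{i=1}^p\sum_{j=1}^pM_{ij}$. *)

theory Defs
  imports
    "HOL-Probability.Probability_Mass_Function"
    "HOL-Library.Multiset"
    "Jordan_Normal_Form.Matrix"
begin

(* Variables are numbered 0, ..., p - 1 instead of 1, ..., p, in accordance with the
   zero-based matrix indices of Jordan_Normal_Form.  States are extensional functions,
   so that equality of states is equality of their p coordinates.  Parameter vectors and
   statistics are indexed by pairs; only the entries at stat_idx p matter. *)

type_synonym state = "nat \<Rightarrow> real"
type_synonym params = "nat \<times> nat \<Rightarrow> real"

definition states :: "nat \<Rightarrow> state set" where
  "states p = {..<p} \<rightarrow>\<^sub>E {0, 1}"

definition stat_idx :: "nat \<Rightarrow> (nat \<times> nat) set" where
  "stat_idx p = {(i, j). i \<le> j \<and> j < p}"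

definition suff_stat :: "state \<Rightarrow> nat \<times> nat \<Rightarrow> real" where
  "suff_stat x = (\<lambda>(i, j). x i * x j)"

definition score :: "nat \<Rightarrow> params \<Rightarrow> state \<Rightarrow> real" where
  "score p \<theta> x = (\<Sum>e\<in>stat_idx p. \<theta> e * suff_stat x e)"

definition partition_fn :: "nat \<Rightarrow> params \<Rightarrow> real" where
  "partition_fn p \<theta> = (\<Sum>x\<in>states p. exp (score p \<theta> x))"

definition markov_net :: "nat \<Rightarrow> params \<Rightarrow> state pmf" where
  "markov_net p \<theta> =
     embed_pmf (\<lambda>x. if x \<in> states p then exp (score p \<theta> x) / partition_fn p \<theta> else 0)"

(* Resampling of coordinate i from the conditional distribution given the others.
   For x in states p the conditioning event has positive probability, see
   conditioning_event_possible below. *)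
definition gibbs_update :: "nat \<Rightarrow> params \<Rightarrow> nat \<Rightarrow> state \<Rightarrow> state pmf" where
  "gibbs_update p \<theta> i x =
     map_pmf (\<lambda>y. x(i := y i))
       (cond_pmf (markov_net p \<theta>) {y. \<forall>k\<in>{..<p} - {i}. y k = x k})"

definition gibbs_sweep :: "nat \<Rightarrow> params \<Rightarrow> state \<Rightarrow> state pmf" where
  "gibbs_sweep p \<theta> x =
     foldl (\<lambda>P i. bind_pmf P (gibbs_update p \<theta> i)) (return_pmf x) [0..<p]"

primrec gibbs :: "nat \<Rightarrow> params \<Rightarrow> nat \<Rightarrow> state \<Rightarrow> state pmf" where
  "gibbs p \<theta> 0 x = return_pmf x"
| "gibbs p \<theta> (Suc \<tau>) x = bind_pmf (gibbs p \<theta> \<tau> x) (gibbs_sweep p \<theta>)"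

definition neg_loglik :: "nat \<Rightarrow> state multiset \<Rightarrow> params \<Rightarrow> real" where
  "neg_loglik p X \<theta> =
     - (1 / real (size X)) * (\<Sum>x\<in>#X. score p \<theta> x) + ln (partition_fn p \<theta>)"

(* Component e of the gradient: the partial derivative in the coordinate e of the
   parameter vector. *)
definition grad :: "nat \<Rightarrow> state multiset \<Rightarrow> params \<Rightarrow> nat \<times> nat \<Rightarrow> real" where
  "grad p X \<theta> e = deriv (\<lambda>t. neg_loglik p X (\<theta>(e := t))) (\<theta> e)"

definition approx_grad :: "state multiset \<Rightarrow> state \<Rightarrow> nat \<times> nat \<Rightarrow> real" where
  "approx_grad X y e = suff_stat y e - (1 / real (size X)) * (\<Sum>x\<in>#X. suff_stat x e)"

definition grad_error ::
  "nat \<Rightarrow> state multiset \<Rightarrow> params \<Rightarrow> state \<Rightarrow> nat \<times> nat \<Rightarrow> real" where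
  "grad_error p X \<theta> y e = approx_grad X y e - grad p X \<theta> e"

definition coupling :: "params \<Rightarrow> nat \<Rightarrow> nat \<Rightarrow> real" where
  "coupling \<theta> i j = \<theta> (min i j, max i j)"

(* The odds P(X_i = 0 | rest) / P(X_i = 1 | rest) with x_j = 0 lie between r_bound and
   s_bound.  Changing x_j from 0 to 1 moves P(X_i = 1 | rest) by the (i, j) formula of
   U_mat with b_star replaced by these odds, and b_star maximises it over that range.
   The formula is used for all i, j; the (nonnegative) diagonal is not set to 0. *)
definition s_bound :: "nat \<Rightarrow> params \<Rightarrow> nat \<Rightarrow> nat \<Rightarrow> real" where
  "s_bound p \<theta> i j =
     exp (- coupling \<theta> i i
          - (\<Sum>k\<in>{..<p} - {i, j}. coupling \<theta> i k * max (- sgn (coupling \<theta> i k)) 0))"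

definition r_bound :: "nat \<Rightarrow> params \<Rightarrow> nat \<Rightarrow> nat \<Rightarrow> real" where
  "r_bound p \<theta> i j =
     exp (- coupling \<theta> i i
          - (\<Sum>k\<in>{..<p} - {i, j}. coupling \<theta> i k * max (sgn (coupling \<theta> i k)) 0))"

definition b_star :: "nat \<Rightarrow> params \<Rightarrow> nat \<Rightarrow> nat \<Rightarrow> real" where
  "b_star p \<theta> i j =
     max (r_bound p \<theta> i j) (min (s_bound p \<theta> i j) (exp (coupling \<theta> i j / 2)))"

definition U_mat :: "nat \<Rightarrow> params \<Rightarrow> real mat" where
  "U_mat p \<theta> = mat p p (\<lambda>(i, j).
     \<bar>exp (- coupling \<theta> i j) - 1\<bar> * b_star p \<theta> i j /
     ((1 + b_star p \<theta> i j * exp (- coupling \<theta> i j)) * (1 + b_star p \<theta> i j)))"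

definition Bi_mat :: "nat \<Rightarrow> params \<Rightarrow> nat \<Rightarrow> real mat" where
  "Bi_mat p \<theta> i = mat p p (\<lambda>(k, l).
     if k = i then U_mat p \<theta> $$ (k, l) else 1\<^sub>m p $$ (k, l))"

(* Each new factor is multiplied from the left. *)
definition B_mat :: "nat \<Rightarrow> params \<Rightarrow> real mat" where
  "B_mat p \<theta> = fold (\<lambda>i M. Bi_mat p \<theta> i * M) [0..<p] (1\<^sub>m p)"

definition entry_sum :: "real mat \<Rightarrow> real" where
  "entry_sum M = (\<Sum>i<dim_row M. \<Sum>j<dim_col M. M $$ (i, j))"

lemma finite_stat_idx [simp]: "finite (stat_idx p)"
  by (rule finite_subset[of _ "{..<p} \<times> {..<p}"]) (auto simp: stat_idx_def)

lemma finite_states [simp]: "finite (states p)"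
  by (simp add: states_def finite_PiE)

lemma states_nonempty [simp]: "states p \<noteq> {}"
  by (simp add: states_def PiE_eq_empty_iff)

lemma partition_fn_pos: "partition_fn p \<theta> > 0"
  unfolding partition_fn_def by (rule sum_pos) auto

lemma pmf_markov_net:
  "pmf (markov_net p \<theta>) x =
     (if x \<in> states p then exp (score p \<theta> x) / partition_fn p \<theta> else 0)"
  unfolding markov_net_def
proof (rule pmf_embed_pmf)
  let ?f = "\<lambda>x. if x \<in> states p then exp (score p \<theta> x) / partition_fn p \<theta> else 0"
  show nn: "?f y \<ge> 0" for y
    using partition_fn_pos[of p \<theta>] by simp
  have "(\<integral>\<^sup>+ y. ennreal (?f y) \<partial>count_space UNIV) = (\<Sum>y\<in>states p. ennreal (?f y))"
    by (intro nn_integral_count_space') auto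
  also have "\<dots> = ennreal (\<Sum>y\<in>states p. ?f y)"
    using nn by (intro sum_ennreal)
  also have "(\<Sum>y\<in>states p. ?f y) = 1"
    using partition_fn_pos[of p \<theta>]
    by (simp add: partition_fn_def flip: sum_divide_distrib)
  finally show "(\<integral>\<^sup>+ y. ennreal (?f y) \<partial>count_space UNIV) = 1"
    by simp
qed

lemma set_pmf_markov_net: "set_pmf (markov_net p \<theta>) = states p"
  using partition_fn_pos[of p \<theta>] by (auto simp: set_pmf_eq pmf_markov_net)

lemma conditioning_event_possible:
  assumes "x \<in> states p"
  shows "set_pmf (markov_net p \<theta>) \<inter> {y. \<forall>k\<in>{..<p} - {i}. y k = x k} \<noteq> {}"
  using assms by (auto simp: set_pmf_markov_net)

lemma DERIV_score:
  assumes "e \<in> stat_idx p"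
  shows "((\<lambda>t. score p (\<theta>(e := t)) x) has_real_derivative suff_stat x e) (at t)"
proof -
  have "score p (\<theta>(e := t)) x =
          t * suff_stat x e + (\<Sum>d\<in>stat_idx p - {e}. \<theta> d * suff_stat x d)" for t
    unfolding score_def using assms by (simp add: sum.remove)
  then show ?thesis
    by (auto intro!: derivative_eq_intros)
qed

lemma DERIV_neg_loglik:
  assumes e: "e \<in> stat_idx p"
  shows "((\<lambda>t. neg_loglik p X (\<theta>(e := t))) has_real_derivative
           measure_pmf.expectation (markov_net p \<theta>) (\<lambda>x. suff_stat x e)
             - (1 / real (size X)) * (\<Sum>x\<in>#X. suff_stat x e)) (at (\<theta> e))"
proof -
  have data: "((\<lambda>t. \<Sum>x\<in>#X. score p (\<theta>(e := t)) x) has_real_derivative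
                (\<Sum>x\<in>#X. suff_stat x e)) (at (\<theta> e))"
  proof (induction X)
    case (add x X)
    from DERIV_add[OF DERIV_score[OF e] add] show ?case
      by (simp only: image_mset_add_mset sum_mset.add_mset)
  qed simp
  have exp_score: "((\<lambda>t. exp (score p (\<theta>(e := t)) x)) has_real_derivative
                exp (score p \<theta> x) * suff_stat x e) (at (\<theta> e))" for x
    using DERIV_chain2[OF DERIV_exp DERIV_score[OF e]] by (metis fun_upd_triv)
  have "((\<lambda>t. partition_fn p (\<theta>(e := t))) has_real_derivative
                (\<Sum>x\<in>states p. exp (score p \<theta> x) * suff_stat x e)) (at (\<theta> e))"
    unfolding partition_fn_def by (intro DERIV_sum exp_score)
  from DERIV_chain2[OF DERIV_ln_divide this] partition_fn_pos[of p \<theta>]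
  have log_part: "((\<lambda>t. ln (partition_fn p (\<theta>(e := t)))) has_real_derivative
      (1 / partition_fn p \<theta>) * (\<Sum>x\<in>states p. exp (score p \<theta> x) * suff_stat x e))
      (at (\<theta> e))"
    by simp
  have "measure_pmf.expectation (markov_net p \<theta>) (\<lambda>x. suff_stat x e) =
          (\<Sum>x\<in>states p. pmf (markov_net p \<theta>) x * suff_stat x e)"
    by (subst integral_measure_pmf_real[where A = "states p"])
       (auto simp: set_pmf_markov_net mult.commute)
  also have "\<dots> =
      (1 / partition_fn p \<theta>) * (\<Sum>x\<in>states p. exp (score p \<theta> x) * suff_stat x e)"
    by (simp add: pmf_markov_net sum_distrib_left)
  finally have expect: "measure_pmf.expectation (markov_net p \<theta>) (\<lambda>x. suff_stat x e) =
      (1 / partition_fn p \<theta>) * (\<Sum>x\<in>states p. exp (score p \<theta> x) * suff_stat x e)" .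
  have "((\<lambda>t. - (1 / real (size X)) * (\<Sum>x\<in>#X. score p (\<theta>(e := t)) x)
           + ln (partition_fn p (\<theta>(e := t)))) has_real_derivative
         - (1 / real (size X)) * (\<Sum>x\<in>#X. suff_stat x e)
           + (1 / partition_fn p \<theta>) * (\<Sum>x\<in>states p. exp (score p \<theta> x) * suff_stat x e))
         (at (\<theta> e))"
    by (intro DERIV_add DERIV_cmult data log_part)
  then show ?thesis
    unfolding neg_loglik_def expect
    by (rule DERIV_cong)
       (simp only: mult_minus_left minus_add_distrib add.commute diff_conv_add_uminus)
qed

lemma grad_eq:
  assumes "e \<in> stat_idx p"
  shows "grad p X \<theta> e =
           measure_pmf.expectation (markov_net p \<theta>) (\<lambda>x. suff_stat x e)
             - (1 / real (size X)) * (\<Sum>x\<in>#X. suff_stat x e)"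
  unfolding grad_def using DERIV_neg_loglik[OF assms] by (rule DERIV_imp_deriv)

lemma grad_error_eq:
  assumes "e \<in> stat_idx p"
  shows "grad_error p X \<theta> y e =
           suff_stat y e - measure_pmf.expectation (markov_net p \<theta>) (\<lambda>x. suff_stat x e)"
  by (simp add: grad_error_def approx_grad_def grad_eq[OF assms])

end

(* Dual form of the coupling argument.  Call c j a bound on the oscillation of f in
   coordinate j if flipping x_j changes f x by at most c j.  Averaging f over a fresh draw
   of coordinate i removes the oscillation in i, but adds at most U_ij times it to the
   oscillation in every other coordinate j, because U_ij bounds the effect of x_j on the
   conditional law of X_i.  Hence one update multiplies the row vector of oscillation
   bounds by B_i, and a sweep multiplies it by B.  The statistics have oscillation at most
   1 in each coordinate, so after tau sweeps the expectations from any two initial states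
   differ by at most the sum of the entries of B^tau; integrating one of these states
   against the stationary law gives the bound (even without the factor 2). *)
theory Submission
  imports Defs
begin

section \<open>Expectations as finite sums over the states\<close>

lemma finite_set_pmf_subset_states:
  "set_pmf P \<subseteq> states p \<Longrightarrow> finite (set_pmf P)"
  by (rule finite_subset[OF _ finite_states])

lemma expectation_states:
  fixes f :: "state \<Rightarrow> real"
  assumes "set_pmf P \<subseteq> states p"
  shows "measure_pmf.expectation P f = (\<Sum>x\<in>states p. pmf P x * f x)"
  using assms by (subst integral_measure_pmf_real[where A = "states p"])
    (auto simp: mult.commute)

lemma states_fun_upd:
  assumes "x \<in> states p" "i < p" "v \<in> {0, 1}"
  shows "x(i := v) \<in> states p"
  using assms by (auto simp: states_def PiE_iff extensional_def)

lemma states_val: "x \<in> states p \<Longrightarrow> k < p \<Longrightarrow> x k = 0 \<or> x k = 1"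
  by (auto simp: states_def PiE_iff)

subsection \<open>The conditional distributions\<close>

text \<open>The conditional odds of \<open>X_i = 0\<close> against \<open>X_i = 1\<close>, so that
  the conditional probability of 1 is \<open>1 / (1 + cond_odds)\<close>. Odds are convenient
  because a change of another coordinate acts on them by a factor.\<close>

definition cond_odds :: "nat \<Rightarrow> params \<Rightarrow> nat \<Rightarrow> state \<Rightarrow> real" where
  "cond_odds p \<theta> i x =
     exp (- coupling \<theta> i i - (\<Sum>k\<in>{..<p} - {i}. coupling \<theta> i k * x k))"

lemma cond_odds_pos: "cond_odds p \<theta> i x > 0"
  by (simp add: cond_odds_def)

lemma cond_odds_fun_upd_same [simp]: "cond_odds p \<theta> i (x(i := v)) = cond_odds p \<theta> i x"
  unfolding cond_odds_def by (auto intro!: arg_cong[where f = exp] sum.cong)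

text \<open>Only statistics whose index pair contains \<open>i\<close> can change. These pairs are
  \<open>(min i k, max i k)\<close>, exactly one for each \<open>k < p\<close>; the pair with
  \<open>k = i\<close> yields the diagonal parameter.\<close>

lemma score_diff:
  assumes i: "i < p"
  shows "score p \<theta> (x(i := 1)) - score p \<theta> (x(i := 0)) =
           coupling \<theta> i i + (\<Sum>k\<in>{..<p} - {i}. coupling \<theta> i k * x k)"
proof -
  let ?h = "\<lambda>k. (min i k, max i k)"
  let ?D = "\<lambda>e. \<theta> e * (suff_stat (x(i := 1)) e - suff_stat (x(i := 0)) e)"
  have inj: "inj_on ?h {..<p}"
    by (auto simp: inj_on_def min_def max_def split: if_splits)
  have "score p \<theta> (x(i := 1)) - score p \<theta> (x(i := 0)) = sum ?D (stat_idx p)"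
    by (simp add: score_def algebra_simps sum_subtractf)
  also have "\<dots> = sum ?D (?h ` {..<p})"
  proof (rule sum.mono_neutral_right)
    show "?h ` {..<p} \<subseteq> stat_idx p"
      using i by (auto simp: stat_idx_def)
    show "\<forall>e\<in>stat_idx p - ?h ` {..<p}. ?D e = 0"
    proof
      fix e assume e: "e \<in> stat_idx p - ?h ` {..<p}"
      obtain a b where ab: "e = (a, b)" by (cases e)
      have "a \<le> b" "b < p" using e ab by (auto simp: stat_idx_def)
      \<comment> \<open>An ordered pair \<open>(a, b)\<close> with \<open>a = i\<close> would be
        \<open>?h b\<close>, and one with \<open>b = i\<close> would be \<open>?h a\<close>.\<close>
      moreover have "e \<noteq> ?h a" "e \<noteq> ?h b" using e \<open>a \<le> b\<close> \<open>b < p\<close> by auto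
      ultimately have "a \<noteq> i" "b \<noteq> i" using ab by (auto simp: min_def max_def)
      then show "?D e = 0" by (simp add: ab suff_stat_def)
    qed
  qed simp
  also have "\<dots> = (\<Sum>k<p. ?D (?h k))"
    using inj by (simp add: sum.reindex)
  also have "\<dots> = ?D (?h i) + (\<Sum>k\<in>{..<p} - {i}. ?D (?h k))"
    using i by (simp add: sum.remove)
  also have "?D (?h i) = coupling \<theta> i i"
    by (simp add: suff_stat_def coupling_def)
  also have "(\<Sum>k\<in>{..<p} - {i}. ?D (?h k)) = (\<Sum>k\<in>{..<p} - {i}. coupling \<theta> i k * x k)"
    by (rule sum.cong) (auto simp: suff_stat_def coupling_def min_def max_def)
  finally show ?thesis .
qed

lemma exp_score_upd_0:
  assumes "i < p"
  shows "exp (score p \<theta> (x(i := 0))) = cond_odds p \<theta> i x * exp (score p \<theta> (x(i := 1)))"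
  using score_diff[OF assms, of \<theta> x] by (simp add: cond_odds_def flip: exp_add)

lemma exp_score_cond_odds:
  assumes "i < p"
  shows "exp (score p \<theta> (x(i := 1))) / (exp (score p \<theta> (x(i := 1))) + exp (score p \<theta> (x(i := 0))))
           = 1 / (1 + cond_odds p \<theta> i x)"
    and "exp (score p \<theta> (x(i := 0))) / (exp (score p \<theta> (x(i := 1))) + exp (score p \<theta> (x(i := 0))))
           = 1 - 1 / (1 + cond_odds p \<theta> i x)"
proof -
  have "E / (E + b * E) = 1 / (1 + b)" "b * E / (E + b * E) = 1 - 1 / (1 + b)"
    if "0 < E" "0 < b" for E b :: real
  proof -
    have "E + b * E = E * (1 + b)" by (simp add: algebra_simps)
    then show "E / (E + b * E) = 1 / (1 + b)" "b * E / (E + b * E) = 1 - 1 / (1 + b)"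
      using that by (simp_all add: diff_divide_distrib[symmetric] divide_simps)
  qed
  from this[OF exp_gt_zero cond_odds_pos] show
    "exp (score p \<theta> (x(i := 1))) / (exp (score p \<theta> (x(i := 1))) + exp (score p \<theta> (x(i := 0))))
       = 1 / (1 + cond_odds p \<theta> i x)"
    "exp (score p \<theta> (x(i := 0))) / (exp (score p \<theta> (x(i := 1))) + exp (score p \<theta> (x(i := 0))))
       = 1 - 1 / (1 + cond_odds p \<theta> i x)"
    unfolding exp_score_upd_0[OF assms] .
qed

subsection \<open>Gibbs updates acting on functions\<close>

text \<open>The transition kernel of \<open>gibbs_update\<close> acting on functions, in closed
  form.\<close>

definition gibbs_avg ::
  "nat \<Rightarrow> params \<Rightarrow> nat \<Rightarrow> (state \<Rightarrow> real) \<Rightarrow> state \<Rightarrow> real" where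
  "gibbs_avg p \<theta> i f x =
     1 / (1 + cond_odds p \<theta> i x) * f (x(i := 1)) +
     (1 - 1 / (1 + cond_odds p \<theta> i x)) * f (x(i := 0))"

lemma gibbs_update_support:
  assumes "x \<in> states p" "i < p"
  shows "states p \<inter> {y. \<forall>k\<in>{..<p} - {i}. y k = x k} = {x(i := 0), x(i := 1)}"
proof -
  have "y = x(i := 0) \<or> y = x(i := 1)"
    if "y \<in> states p" "\<forall>k\<in>{..<p} - {i}. y k = x k" for y
  proof -
    have "y = x(i := y i)"
    proof
      fix k show "y k = (x(i := y i)) k"
        using that assms by (cases "k < p") (auto simp: states_def PiE_iff extensional_def)
    qed
    with states_val[OF that(1) assms(2)] obtain v where "y = x(i := v)" "v = 0 \<or> v = 1"
      by blast
    then show ?thesis by blast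
  qed
  then have "states p \<inter> {y. \<forall>k\<in>{..<p} - {i}. y k = x k} \<subseteq> {x(i := 0), x(i := 1)}"
    by blast
  moreover have "{x(i := 0), x(i := 1)} \<subseteq> states p \<inter> {y. \<forall>k\<in>{..<p} - {i}. y k = x k}"
    using states_fun_upd[OF assms, of 0] states_fun_upd[OF assms, of 1] by simp
  ultimately show ?thesis by (rule equalityI)
qed

lemma set_gibbs_update:
  assumes "x \<in> states p" "i < p"
  shows "set_pmf (gibbs_update p \<theta> i x) = {x(i := 0), x(i := 1)}"
  unfolding gibbs_update_def
  using assms conditioning_event_possible[OF assms(1), of \<theta> i]
  by (auto simp: set_cond_pmf set_pmf_markov_net gibbs_update_support)

lemma expectation_gibbs_update:
  assumes x: "x \<in> states p" and i: "i < p"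
  shows "measure_pmf.expectation (gibbs_update p \<theta> i x) f = gibbs_avg p \<theta> i f x"
proof -
  let ?S = "{y. \<forall>k\<in>{..<p} - {i}. y k = x k}"
  let ?C = "cond_pmf (markov_net p \<theta>) ?S"
  let ?w = "\<lambda>v. exp (score p \<theta> (x(i := v)))"
  note poss = conditioning_event_possible[OF x, of \<theta> i]
  have set: "set_pmf ?C = {x(i := 0), x(i := 1)}"
    using poss gibbs_update_support[OF x i] by (simp add: set_cond_pmf set_pmf_markov_net)
  have ne: "x(i := 0) \<noteq> x(i := 1)"
    by (metis fun_upd_eqD zero_neq_one)
  \<comment> \<open>Both states in the support share this normalising factor. The probability of the
    conditioning event need not be computed: the two masses add up to 1, which determines
    \<open>m\<close>.\<close>
  define m where "m = 1 / (partition_fn p \<theta> * measure_pmf.prob (markov_net p \<theta>) ?S)"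
  have pmf: "pmf ?C (x(i := v)) = ?w v * m" if "v \<in> {0, 1}" for v
    using pmf_cond[OF poss] states_fun_upd[OF x i that]
    by (simp add: pmf_markov_net m_def)
  have "sum (pmf ?C) {x(i := 0), x(i := 1)} = 1"
    by (rule sum_pmf_eq_1) (auto simp: set)
  then have "(?w 1 + ?w 0) * m = 1"
    using ne pmf by (simp add: algebra_simps)
  then have m: "m = 1 / (?w 1 + ?w 0)"
    by (metis mult_zero_left nonzero_mult_div_cancel_left zero_neq_one)
  have "measure_pmf.expectation (gibbs_update p \<theta> i x) f
          = measure_pmf.expectation ?C (\<lambda>y. f (x(i := y i)))"
    unfolding gibbs_update_def by simp
  also have "\<dots> = (\<Sum>y\<in>{x(i := 0), x(i := 1)}. f (x(i := y i)) * pmf ?C y)"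
    by (rule integral_measure_pmf_real) (auto simp: set)
  also have "\<dots> = ?w 1 / (?w 1 + ?w 0) * f (x(i := 1)) + ?w 0 / (?w 1 + ?w 0) * f (x(i := 0))"
    using ne pmf by (simp add: m mult.commute)
  finally show ?thesis
    unfolding gibbs_avg_def exp_score_cond_odds[OF i] .
qed

text \<open>A form expressed through \<open>x\<close> and its flip at \<open>i\<close>, suited to
  the change of variables in the stationarity proof.\<close>

lemma gibbs_avg_flip:
  assumes "x \<in> states p" "i < p"
  shows "gibbs_avg p \<theta> i f x =
    (exp (score p \<theta> x) * f x + exp (score p \<theta> (x(i := 1 - x i))) * f (x(i := 1 - x i))) /
    (exp (score p \<theta> x) + exp (score p \<theta> (x(i := 1 - x i))))"
proof -
  have *: "gibbs_avg p \<theta> i f x =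
    (exp (score p \<theta> (x(i := 1))) * f (x(i := 1)) + exp (score p \<theta> (x(i := 0))) * f (x(i := 0))) /
    (exp (score p \<theta> (x(i := 1))) + exp (score p \<theta> (x(i := 0))))"
    unfolding gibbs_avg_def exp_score_cond_odds(2)[OF assms(2), of \<theta> x, symmetric]
    by (simp only: exp_score_cond_odds(1)[OF assms(2), symmetric] times_divide_eq_left
        add_divide_distrib)
  from states_val[OF assms] show ?thesis
  proof
    assume "x i = 0"
    then have "x(i := 0) = x" by (simp add: fun_upd_idem)
    then show ?thesis using * \<open>x i = 0\<close> by (simp add: add.commute)
  next
    assume "x i = 1"
    then have "x(i := 1) = x" by (simp add: fun_upd_idem)
    then show ?thesis using * \<open>x i = 1\<close> by simp
  qed
qed

text \<open>Reversibility: the flow \<open>w x * w (\<sigma> x) / (w x + w (\<sigma> x))\<close>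
  between a state and its flip is symmetric. Reindexing by the involution \<sigma> therefore returns
  to each \<open>x\<close> the mass that it sends to its flip.\<close>

lemma gibbs_avg_stationary:
  assumes i: "i < p"
  shows "measure_pmf.expectation (markov_net p \<theta>) (gibbs_avg p \<theta> i f)
           = measure_pmf.expectation (markov_net p \<theta>) f"
proof -
  define w where "w x = exp (score p \<theta> x)" for x
  define \<sigma> where "\<sigma> x = x(i := 1 - x i)" for x :: state
  have \<sigma>: "\<sigma> x \<in> states p" "\<sigma> (\<sigma> x) = x" if "x \<in> states p" for x
    using states_val[OF that i] by (auto simp: \<sigma>_def intro: states_fun_upd[OF that i])
  have "(\<Sum>x\<in>states p. w x * gibbs_avg p \<theta> i f x) =
          (\<Sum>x\<in>states p. w x * w x / (w x + w (\<sigma> x)) * f x) +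
          (\<Sum>x\<in>states p. w x * w (\<sigma> x) / (w x + w (\<sigma> x)) * f (\<sigma> x))"
    unfolding sum.distrib[symmetric]
    by (rule sum.cong)
       (simp_all add: gibbs_avg_flip[OF _ i] w_def \<sigma>_def add_divide_distrib algebra_simps)
  also have "(\<Sum>x\<in>states p. w x * w (\<sigma> x) / (w x + w (\<sigma> x)) * f (\<sigma> x)) =
               (\<Sum>x\<in>states p. w (\<sigma> x) * w x / (w x + w (\<sigma> x)) * f x)"
    by (rule sum.reindex_bij_witness[of _ \<sigma> \<sigma>]) (auto simp: \<sigma> add.commute)
  also have "(\<Sum>x\<in>states p. w x * w x / (w x + w (\<sigma> x)) * f x) + \<dots> =
               (\<Sum>x\<in>states p. w x * f x)"
    unfolding sum.distrib[symmetric]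
  proof (rule sum.cong)
    fix x
    have "w x + w (\<sigma> x) > 0" by (simp add: w_def add_pos_pos)
    then show "w x * w x / (w x + w (\<sigma> x)) * f x + w (\<sigma> x) * w x / (w x + w (\<sigma> x)) * f x
                 = w x * f x"
      by (simp add: divide_simps) (simp add: algebra_simps)
  qed simp
  finally show ?thesis
    by (simp add: expectation_states[where p = p] set_pmf_markov_net pmf_markov_net
        flip: w_def sum_divide_distrib)
qed

text \<open>Operators on functions compose in the reverse order of time: the average over coordinate
  0, which is resampled first, is the outermost.\<close>

definition sweep_avg :: "nat \<Rightarrow> params \<Rightarrow> (state \<Rightarrow> real) \<Rightarrow> state \<Rightarrow> real" where
  "sweep_avg p \<theta> f = foldr (gibbs_avg p \<theta>) [0..<p] f"

lemma sweep_avg_stationary: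
  "measure_pmf.expectation (markov_net p \<theta>) (sweep_avg p \<theta> f)
     = measure_pmf.expectation (markov_net p \<theta>) f"
proof -
  have "measure_pmf.expectation (markov_net p \<theta>) (foldr (gibbs_avg p \<theta>) is f)
          = measure_pmf.expectation (markov_net p \<theta>) f" if "set is \<subseteq> {..<p}" for "is"
    using that by (induction "is") (simp_all add: gibbs_avg_stationary)
  then show ?thesis unfolding sweep_avg_def by (simp add: atLeast0LessThan)
qed

section \<open>From distributions of the chain to averaging operators\<close>

lemma set_gibbs_bind_updates:
  assumes "set_pmf P \<subseteq> states p" "set is \<subseteq> {..<p}"
  shows "set_pmf (foldl (\<lambda>P i. bind_pmf P (gibbs_update p \<theta> i)) P is) \<subseteq> states p"
  using assms
proof (induction "is" arbitrary: P)
  case (Cons i "is")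
  have "set_pmf (bind_pmf P (gibbs_update p \<theta> i)) \<subseteq> states p"
    using Cons.prems by (auto simp: set_gibbs_update subset_iff intro: states_fun_upd)
  then show ?case using Cons by simp
qed simp

text \<open>The tower rule, with the conditions on \<open>Q\<close> restricted to states, because
  the Gibbs kernels are controlled only there.\<close>

lemma expectation_bind_states:
  fixes f :: "state \<Rightarrow> real"
  assumes "set_pmf P \<subseteq> states p"
    and "\<And>x. x \<in> states p \<Longrightarrow> finite (set_pmf (Q x))"
    and "\<And>x. x \<in> states p \<Longrightarrow> measure_pmf.expectation (Q x) f = g x"
  shows "measure_pmf.expectation (bind_pmf P Q) f = measure_pmf.expectation P g"
  using assms
  by (subst pmf_expectation_bind[of "states p"]) (simp_all add: expectation_states)

lemma expectation_bind_updates: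
  assumes "set_pmf P \<subseteq> states p" "set is \<subseteq> {..<p}"
  shows "measure_pmf.expectation (foldl (\<lambda>P i. bind_pmf P (gibbs_update p \<theta> i)) P is) f
           = measure_pmf.expectation P (foldr (gibbs_avg p \<theta>) is f)"
  using assms
proof (induction "is" arbitrary: P)
  case (Cons i "is")
  have "set_pmf (bind_pmf P (gibbs_update p \<theta> i)) \<subseteq> states p"
    using Cons.prems by (auto simp: set_gibbs_update subset_iff intro: states_fun_upd)
  moreover have "measure_pmf.expectation (bind_pmf P (gibbs_update p \<theta> i)) g
      = measure_pmf.expectation P (gibbs_avg p \<theta> i g)" for g
    using Cons.prems
    by (intro expectation_bind_states) (auto simp: set_gibbs_update expectation_gibbs_update)
  ultimately show ?case using Cons by simp
qed simp

lemma set_gibbs_sweep: "x \<in> states p \<Longrightarrow> set_pmf (gibbs_sweep p \<theta> x) \<subseteq> states p"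
  unfolding gibbs_sweep_def by (rule set_gibbs_bind_updates) auto

lemma expectation_gibbs_sweep:
  "x \<in> states p \<Longrightarrow> measure_pmf.expectation (gibbs_sweep p \<theta> x) f = sweep_avg p \<theta> f x"
  unfolding gibbs_sweep_def sweep_avg_def by (subst expectation_bind_updates) auto

lemma set_gibbs: "x \<in> states p \<Longrightarrow> set_pmf (gibbs p \<theta> \<tau> x) \<subseteq> states p"
  by (induction \<tau>) (use set_gibbs_sweep in \<open>auto simp: subset_iff\<close>)

lemma expectation_gibbs:
  assumes x: "x \<in> states p"
  shows "measure_pmf.expectation (gibbs p \<theta> \<tau> x) f = (sweep_avg p \<theta> ^^ \<tau>) f x"
\<comment> \<open>The function has to vary: the last sweep is absorbed into it before the induction
  hypothesis applies.\<close>
proof (induction \<tau> arbitrary: f)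
  case (Suc \<tau>)
  have "measure_pmf.expectation (gibbs p \<theta> (Suc \<tau>) x) f
          = measure_pmf.expectation (gibbs p \<theta> \<tau> x) (sweep_avg p \<theta> f)"
    unfolding gibbs.simps
    by (intro expectation_bind_states[where p = p] set_gibbs x expectation_gibbs_sweep
        finite_set_pmf_subset_states[OF set_gibbs_sweep])
  then show ?case using Suc by (simp add: funpow_swap1)
qed simp

subsection \<open>Influence of one coordinate on another\<close>

text \<open>The difference of the two sides, over a common denominator, has numerator
  \<open>(\<beta> - b) * (1 - c * b * \<beta>)\<close>, where \<open>\<beta>\<close> is the projection of the unconstrained
  maximiser \<open>t\<close> onto the interval.\<close>

lemma odds_difference_max:
  fixes r s t c b :: real
  assumes r: "0 < r" "r \<le> b" and s: "b \<le> s" and t: "0 < t" "t * t * c = 1" and c: "0 < c"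
  defines "\<beta> \<equiv> max r (min s t)"
  shows "b / ((1 + b * c) * (1 + b)) \<le> \<beta> / ((1 + \<beta> * c) * (1 + \<beta>))"
proof -
  have b: "b > 0" and \<beta>: "\<beta> > 0"
    using r by (auto simp: \<beta>_def)
  have "(\<beta> - b) * (1 - c * b * \<beta>) \<ge> 0"
  proof -
    \<comment> \<open>If the projection is \<open>t\<close> itself, \<open>t\<close> times the
      product is the square of \<open>t - b\<close>. At an endpoint both factors are nonpositive (at
      \<open>r\<close>) or both are nonnegative (at \<open>s\<close>).\<close>
    consider "\<beta> = t" | "\<beta> = r" "t \<le> r" | "\<beta> = s" "s \<le> t"
      using r s unfolding \<beta>_def by linarith
    then show ?thesis
    proof cases
      case 1
      have "t * (c * b * t) = b" using t(2) by (metis mult.assoc mult.commute mult_1)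
      moreover have "t * ((\<beta> - b) * (1 - c * b * \<beta>)) = (t - b) * (t - t * (c * b * t))"
        using 1 by (simp add: algebra_simps)
      ultimately have "t * ((\<beta> - b) * (1 - c * b * \<beta>)) = (t - b) * (t - b)"
        by (simp only:)
      then have "0 \<le> t * ((\<beta> - b) * (1 - c * b * \<beta>))" by simp
      then show ?thesis using t(1) by (simp add: zero_le_mult_iff)
    next
      case 2
      have "t * t \<le> b * r" using 2 r t by (intro mult_mono) auto
      then have "1 \<le> c * b * r" using c t(2) mult_left_mono[of "t * t" "b * r" c]
        by (simp add: mult_ac)
      then show ?thesis using 2 r by (intro mult_nonpos_nonpos) auto
    next
      case 3
      have "b * s \<le> t * t" using 3 s b t by (intro mult_mono) auto
      then have "c * b * s \<le> 1" using c t(2) mult_left_mono[of "b * s" "t * t" c]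
        by (simp add: mult_ac)
      then show ?thesis using 3 s by (intro mult_nonneg_nonneg) auto
    qed
  qed
  then have "b * ((1 + \<beta> * c) * (1 + \<beta>)) \<le> \<beta> * ((1 + b * c) * (1 + b))"
    by (simp add: algebra_simps)
  then show ?thesis
    using b \<beta> c by (simp add: divide_simps add_pos_pos zero_less_mult_iff mult_ac)
qed

text \<open>Since \<open>x j = 0\<close>, the term of \<open>j\<close> drops out. Each other term
  \<open>coupling \<theta> i k * x k\<close> lies between the negative and the positive part of the
  coupling, and these are the summands in \<open>s_bound\<close> and \<open>r_bound\<close>.\<close>

lemma cond_odds_bounds:
  assumes x: "x \<in> states p" and ij: "i \<noteq> j" "x j = 0"
  shows "r_bound p \<theta> i j \<le> cond_odds p \<theta> i x" and "cond_odds p \<theta> i x \<le> s_bound p \<theta> i j"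
proof -
  have eq: "cond_odds p \<theta> i x =
      exp (- coupling \<theta> i i - (\<Sum>k\<in>{..<p} - {i, j}. coupling \<theta> i k * x k))"
    unfolding cond_odds_def using ij
    by (auto intro!: arg_cong[where f = exp] sum.mono_neutral_right)
  have "coupling \<theta> i k * x k \<le> coupling \<theta> i k * max (sgn (coupling \<theta> i k)) 0"
    and "coupling \<theta> i k * max (- sgn (coupling \<theta> i k)) 0 \<le> coupling \<theta> i k * x k"
    if "k < p" for k
    using states_val[OF x that] by (auto simp: sgn_if)
  then show "r_bound p \<theta> i j \<le> cond_odds p \<theta> i x" "cond_odds p \<theta> i x \<le> s_bound p \<theta> i j"
    unfolding eq r_bound_def s_bound_def by (auto intro!: sum_mono)
qed

lemma U_mat_nonneg: "i < p \<Longrightarrow> j < p \<Longrightarrow> 0 \<le> U_mat p \<theta> $$ (i, j)"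
proof -
  have "b_star p \<theta> i j > 0"
    by (simp add: b_star_def r_bound_def less_max_iff_disj)
  then show "i < p \<Longrightarrow> j < p \<Longrightarrow> 0 \<le> U_mat p \<theta> $$ (i, j)"
    by (simp add: U_mat_def)
qed

text \<open>Raising \<open>x_j\<close> from 0 to 1 multiplies the odds \<open>b\<close> by
  \<open>c\<close>, so the probability moves by
  \<open>\<bar>c - 1\<bar> * b / ((1 + b * c) * (1 + b))\<close>. It remains to maximise this over
  the admissible range of \<open>b\<close>.\<close>

lemma cond_prob_influence:
  assumes x: "x \<in> states p" and ij: "i < p" "j < p" "i \<noteq> j"
  shows "\<bar>1 / (1 + cond_odds p \<theta> i (x(j := 1))) - 1 / (1 + cond_odds p \<theta> i (x(j := 0)))\<bar>
           \<le> U_mat p \<theta> $$ (i, j)"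
proof -
  define b where "b = cond_odds p \<theta> i (x(j := 0))"
  define c where "c = exp (- coupling \<theta> i j)"
  define \<beta> where "\<beta> = b_star p \<theta> i j"
  have b: "b > 0" and c: "c > 0" by (simp_all add: b_def c_def cond_odds_pos)
  have "(\<Sum>k\<in>{..<p} - {i}. coupling \<theta> i k * (x(j := v)) k) =
          coupling \<theta> i j * v + (\<Sum>k\<in>{..<p} - {i} - {j}. coupling \<theta> i k * x k)" for v
    using ij by (subst sum.remove[of _ j]) (auto intro!: sum.cong)
  then have b1: "cond_odds p \<theta> i (x(j := 1)) = b * c"
    by (simp add: b_def c_def cond_odds_def flip: exp_add)
  have "1 + b * c > 0" "1 + b > 0"
    using b c by (simp_all add: add_pos_pos)
  then have "1 / (1 + b * c) - 1 / (1 + b) = (1 - c) * (b / ((1 + b * c) * (1 + b)))"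
    by (simp add: divide_simps) (simp add: algebra_simps)
  moreover have "b / ((1 + b * c) * (1 + b)) > 0"
    using b c by (simp add: add_pos_pos)
  ultimately have "\<bar>1 / (1 + b * c) - 1 / (1 + b)\<bar> = \<bar>c - 1\<bar> * (b / ((1 + b * c) * (1 + b)))"
    by (simp only: abs_mult abs_of_pos abs_minus_commute[of c 1])
  also have "\<dots> \<le> \<bar>c - 1\<bar> * (\<beta> / ((1 + \<beta> * c) * (1 + \<beta>)))"
    unfolding \<beta>_def b_star_def
  proof (intro mult_left_mono odds_difference_max)
    have x0: "x(j := 0) \<in> states p" using x ij by (auto intro: states_fun_upd)
    show "r_bound p \<theta> i j \<le> b" "b \<le> s_bound p \<theta> i j"
      unfolding b_def using ij by (auto intro!: cond_odds_bounds[OF x0])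
    \<comment> \<open>The unconstrained maximiser is 1 over the square root of \<open>c\<close>,
      that is, \<open>exp (coupling \<theta> i j / 2)\<close>.\<close>
    show "exp (coupling \<theta> i j / 2) * exp (coupling \<theta> i j / 2) * c = 1"
      by (simp add: c_def flip: exp_add)
  qed (simp_all add: c r_bound_def)
  also have "\<dots> = U_mat p \<theta> $$ (i, j)"
    using ij by (simp add: U_mat_def c_def \<beta>_def)
  finally show ?thesis by (simp add: b1 b_def)
qed

subsection \<open>Oscillations\<close>

definition osc_le :: "nat \<Rightarrow> (state \<Rightarrow> real) \<Rightarrow> (nat \<Rightarrow> real) \<Rightarrow> bool" where
  "osc_le p f c \<longleftrightarrow> (\<forall>x\<in>states p. \<forall>j<p. \<bar>f (x(j := 1)) - f (x(j := 0))\<bar> \<le> c j)"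

lemma osc_leD: "osc_le p f c \<Longrightarrow> x \<in> states p \<Longrightarrow> j < p \<Longrightarrow>
    \<bar>f (x(j := 1)) - f (x(j := 0))\<bar> \<le> c j"
  by (simp add: osc_le_def)

text \<open>Telescoping: \<open>z n\<close> passes from \<open>y\<close> to \<open>x\<close> by
  replacing one coordinate at a time, at a cost of at most \<open>c n\<close> each.\<close>

lemma osc_le_imp_diff_le:
  assumes osc: "osc_le p f c" and x: "x \<in> states p" and y: "y \<in> states p"
  shows "\<bar>f x - f y\<bar> \<le> (\<Sum>j<p. c j)"
proof -
  define z where "z n = (\<lambda>k. if k < n then x k else y k)" for n
  have z_mem: "z n \<in> states p" if "n \<le> p" for n
    using x y that by (auto simp: z_def states_def PiE_iff extensional_def)
  have "n \<le> p \<Longrightarrow> \<bar>f (z n) - f y\<bar> \<le> (\<Sum>j<n. c j)" for n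
  proof (induction n)
    case 0
    then show ?case by (simp add: z_def)
  next
    case (Suc n)
    then have n: "n < p" by simp
    have z: "z n = (z n)(n := y n)" "z (Suc n) = (z n)(n := x n)"
      by (auto simp: z_def fun_eq_iff less_Suc_eq)
    have c: "\<bar>f ((z n)(n := 1)) - f ((z n)(n := 0))\<bar> \<le> c n"
      using osc_leD[OF osc z_mem n] n by simp
    have "\<bar>f (z (Suc n)) - f (z n)\<bar> \<le> c n"
      \<comment> \<open>The two values at \<open>n\<close> either agree, giving difference 0, or are
        0 and 1 in some order, giving the pair in \<open>c\<close>.\<close>
      unfolding z(2) using c z(1) states_val[OF x n] states_val[OF y n]
      by (metis abs_ge_zero abs_minus_commute cancel_comm_monoid_add_class.diff_cancel
          abs_zero order_trans)
    then show ?case using Suc by simp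
  qed
  from this[of p] have "\<bar>f (z p) - f y\<bar> \<le> (\<Sum>j<p. c j)" by simp
  moreover have "z p = x"
    using x y by (auto simp: z_def fun_eq_iff states_def PiE_iff extensional_def)
  ultimately show ?thesis by simp
qed

text \<open>For \<open>j\<close> other than \<open>i\<close>, \<open>x_j\<close> enters twice:
  through \<open>f\<close>, at cost \<open>c j\<close>, and through the law of the new value at
  \<open>i\<close>, at cost \<open>U_ij\<close> times the oscillation of \<open>f\<close> in
  \<open>i\<close>.\<close>

lemma gibbs_avg_osc:
  assumes osc: "osc_le p f c" and i: "i < p"
  shows "osc_le p (gibbs_avg p \<theta> i f)
           (\<lambda>j. (if j = i then 0 else c j) + c i * U_mat p \<theta> $$ (i, j))"
  unfolding osc_le_def
proof (intro ballI allI impI)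
  fix x j assume x: "x \<in> states p" and j: "j < p"
  have ci: "0 \<le> c i" using osc_leD[OF osc x i] by linarith
  show "\<bar>gibbs_avg p \<theta> i f (x(j := 1)) - gibbs_avg p \<theta> i f (x(j := 0))\<bar>
          \<le> (if j = i then 0 else c j) + c i * U_mat p \<theta> $$ (i, j)"
  proof (cases "j = i")
    case True
    \<comment> \<open>The average ignores the old value at \<open>i\<close>, so the left side is 0
      and any nonnegative diagonal entry of \<open>U_mat\<close> will do.\<close>
    then show ?thesis using ci U_mat_nonneg[OF i i] by (simp add: gibbs_avg_def)
  next
    case False
    define q where "q v = 1 / (1 + cond_odds p \<theta> i (x(j := v)))" for v
    define F where "F v u = f (x(j := v, i := u))" for v u
    have q: "0 \<le> q v" "q v \<le> 1" for v
      using cond_odds_pos[of p \<theta> i "x(j := v)"] by (simp_all add: q_def)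
    have cj: "\<bar>F 1 u - F 0 u\<bar> \<le> c j" if "u \<in> {0, 1}" for u
      using osc_leD[OF osc states_fun_upd[OF x i that] j] False
      by (simp add: F_def fun_upd_twist)
    have F0: "\<bar>F 0 1 - F 0 0\<bar> \<le> c i"
      using osc_leD[OF osc states_fun_upd[OF x j] i] by (simp add: F_def)
    have avg: "gibbs_avg p \<theta> i f (x(j := v)) = q v * F v 1 + (1 - q v) * F v 0" for v
      by (simp add: gibbs_avg_def q_def F_def)
    \<comment> \<open>First \<open>x_j\<close> changes in \<open>f\<close> under the law
      \<open>q 1\<close>; then the law changes while \<open>f\<close> is kept at
      \<open>x_j = 0\<close>.\<close>
    have "gibbs_avg p \<theta> i f (x(j := 1)) - gibbs_avg p \<theta> i f (x(j := 0)) =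
        q 1 * (F 1 1 - F 0 1) + (1 - q 1) * (F 1 0 - F 0 0) + (q 1 - q 0) * (F 0 1 - F 0 0)"
      by (simp add: avg algebra_simps)
    also have "\<bar>\<dots>\<bar> \<le> q 1 * \<bar>F 1 1 - F 0 1\<bar> + (1 - q 1) * \<bar>F 1 0 - F 0 0\<bar>
        + \<bar>q 1 - q 0\<bar> * \<bar>F 0 1 - F 0 0\<bar>"
      using q[of 1]
      by (intro order_trans[OF abs_triangle_ineq] add_mono) (simp_all add: abs_mult)
    also have "\<dots> \<le> q 1 * c j + (1 - q 1) * c j + U_mat p \<theta> $$ (i, j) * c i"
      using q[of 1] cj[of 0] cj[of 1] F0 cond_prob_influence[OF x i j] False
        U_mat_nonneg[OF i j]
      by (intro add_mono mult_left_mono mult_mono) (auto simp: q_def)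
    finally show ?thesis using False by (simp add: algebra_simps)
  qed
qed

subsection \<open>Oscillations bounded by column sums\<close>

text \<open>The all-ones row vector times \<open>M\<close>. Writing oscillation bounds in this form
  turns their propagation into matrix products, and their total is \<open>entry_sum\<close>.\<close>

definition col_sum :: "real mat \<Rightarrow> nat \<Rightarrow> real" where
  "col_sum M j = (\<Sum>k<dim_row M. M $$ (k, j))"

lemma entry_sum_col_sum: "entry_sum M = (\<Sum>j<dim_col M. col_sum M j)"
  unfolding entry_sum_def col_sum_def by (rule sum.swap)

lemma col_sum_mult:
  assumes "M \<in> carrier_mat m n" "N \<in> carrier_mat n l" "j < l"
  shows "col_sum (M * N) j = (\<Sum>k<n. col_sum M k * N $$ (k, j))"
proof -
  have "col_sum (M * N) j = (\<Sum>i<m. \<Sum>k<n. M $$ (i, k) * N $$ (k, j))"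
    using assms by (auto simp: col_sum_def scalar_prod_def atLeast0LessThan intro!: sum.cong)
  also have "\<dots> = (\<Sum>k<n. col_sum M k * N $$ (k, j))"
    using assms by (subst sum.swap) (simp add: col_sum_def sum_distrib_right)
  finally show ?thesis .
qed

lemma Bi_mat_carrier [simp]: "Bi_mat p \<theta> i \<in> carrier_mat p p"
  by (simp add: Bi_mat_def)

lemma fold_Bi_mat_carrier [simp]:
  "fold (\<lambda>i M. Bi_mat p \<theta> i * M) is (1\<^sub>m p) \<in> carrier_mat p p"
  by (induction "is" rule: rev_induct) (auto intro: mult_carrier_mat[OF Bi_mat_carrier])

lemma B_mat_carrier [simp]: "B_mat p \<theta> \<in> carrier_mat p p"
  by (simp add: B_mat_def)

text \<open>The identity rows of \<open>Bi_mat\<close> keep the bounds at \<open>j\<close> other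
  than \<open>i\<close>; row \<open>i\<close> replaces the bound at \<open>i\<close> by its
  multiples by \<open>U_ij\<close>, spread over all columns.\<close>

lemma gibbs_avg_osc_col_sum:
  assumes osc: "osc_le p f (col_sum M)" and i: "i < p" and M: "M \<in> carrier_mat p p"
  shows "osc_le p (gibbs_avg p \<theta> i f) (col_sum (M * Bi_mat p \<theta> i))"
proof -
  have "col_sum (M * Bi_mat p \<theta> i) j =
      (if j = i then 0 else col_sum M j) + col_sum M i * U_mat p \<theta> $$ (i, j)" if j: "j < p" for j
  proof -
    have "col_sum (M * Bi_mat p \<theta> i) j =
        col_sum M i * U_mat p \<theta> $$ (i, j)
        + (\<Sum>k\<in>{..<p} - {i}. col_sum M k * Bi_mat p \<theta> i $$ (k, j))"
      unfolding col_sum_mult[OF M Bi_mat_carrier j]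
      using i j by (subst sum.remove[of _ i]) (simp_all add: Bi_mat_def)
    also have "(\<Sum>k\<in>{..<p} - {i}. col_sum M k * Bi_mat p \<theta> i $$ (k, j)) =
        (\<Sum>k\<in>{..<p} - {i}. if k = j then col_sum M k else 0)"
      using j by (intro sum.cong) (auto simp: Bi_mat_def)
    finally show ?thesis using j by (simp add: sum.delta)
  qed
  then show ?thesis using gibbs_avg_osc[OF osc i, of \<theta>] by (simp add: osc_le_def)
qed

lemma sweep_avg_osc:
  assumes osc: "osc_le p f (col_sum M)" and M: "M \<in> carrier_mat p p"
  shows "osc_le p (sweep_avg p \<theta> f) (col_sum (M * B_mat p \<theta>))"
proof -
  have "osc_le p (foldr (gibbs_avg p \<theta>) is f)
          (col_sum (M * fold (\<lambda>i M. Bi_mat p \<theta> i * M) is (1\<^sub>m p)))"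
    if "set is \<subseteq> {..<p}" for "is"
    using that osc M
  \<comment> \<open>The last index is peeled off: its average acts on \<open>f\<close> first, and
    its factor is the leftmost in the product, hence next to \<open>M\<close>.\<close>
  proof (induction "is" arbitrary: f M rule: rev_induct)
    case Nil
    then show ?case by simp
  next
    case (snoc i "is")
    have "osc_le p (foldr (gibbs_avg p \<theta>) is (gibbs_avg p \<theta> i f))
        (col_sum (M * Bi_mat p \<theta> i * fold (\<lambda>i M. Bi_mat p \<theta> i * M) is (1\<^sub>m p)))"
      using snoc.prems
      by (intro snoc.IH gibbs_avg_osc_col_sum) (auto intro: mult_carrier_mat)
    then show ?case
      by (simp add: assoc_mult_mat[OF snoc.prems(3) Bi_mat_carrier fold_Bi_mat_carrier])
  qed
  then show ?thesis unfolding sweep_avg_def B_mat_def by (simp add: atLeast0LessThan)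
qed

text \<open>The induction starts from the identity matrix, whose column sums are the constant bound
  1.\<close>

lemma sweep_avg_funpow_osc:
  assumes "osc_le p f (\<lambda>_. 1)"
  shows "osc_le p ((sweep_avg p \<theta> ^^ \<tau>) f) (col_sum (B_mat p \<theta> ^\<^sub>m \<tau>))"
proof (induction \<tau>)
  case 0
  have "col_sum (1\<^sub>m p) j = 1" if "j < p" for j
    using that by (simp add: col_sum_def sum.delta)
  then show ?case using assms carrier_matD(1)[OF B_mat_carrier, of p \<theta>] by (simp add: osc_le_def)
next
  case (Suc \<tau>)
  then show ?case by (simp add: sweep_avg_osc pow_carrier_mat)
qed

lemma suff_stat_osc:
  assumes "e \<in> stat_idx p"
  shows "osc_le p (\<lambda>x. suff_stat x e) (\<lambda>_. 1)"
proof -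
  obtain a b where e: "e = (a, b)" "a < p" "b < p"
    using assms by (auto simp: stat_idx_def)
  show ?thesis
    unfolding osc_le_def
  proof (intro ballI allI impI)
    fix x j assume x: "x \<in> states p"
    show "\<bar>suff_stat (x(j := 1)) e - suff_stat (x(j := 0)) e\<bar> \<le> 1"
      using e(1) states_val[OF x e(2)] states_val[OF x e(3)] by (auto simp: suff_stat_def)
  qed
qed

text \<open>By stationarity \<open>f\<close> and its iterated average \<open>g\<close> have the same
  mean under the network. The bias is thus the mean of \<open>g x - g y\<close> over a stationary
  \<open>y\<close>, and every such difference is at most the total oscillation of
  \<open>g\<close>.\<close>

lemma gibbs_bias:
  assumes x: "x \<in> states p" and osc: "osc_le p f (\<lambda>_. 1)"
  shows "\<bar>measure_pmf.expectation (gibbs p \<theta> \<tau> x) f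
            - measure_pmf.expectation (markov_net p \<theta>) f\<bar> \<le> entry_sum (B_mat p \<theta> ^\<^sub>m \<tau>)"
proof -
  define g where "g = (sweep_avg p \<theta> ^^ \<tau>) f"
  define G where "G = entry_sum (B_mat p \<theta> ^\<^sub>m \<tau>)"
  let ?\<mu> = "markov_net p \<theta>"
  have int: "integrable ?\<mu> h" for h :: "state \<Rightarrow> real"
    by (rule integrable_measure_pmf_finite) (simp add: set_pmf_markov_net)
  have "measure_pmf.expectation ?\<mu> g = measure_pmf.expectation ?\<mu> f"
    unfolding g_def by (induction \<tau>) (simp_all add: sweep_avg_stationary)
  then have "measure_pmf.expectation (gibbs p \<theta> \<tau> x) f - measure_pmf.expectation ?\<mu> f
      = measure_pmf.expectation ?\<mu> (\<lambda>y. g x - g y)"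
    using int by (simp add: expectation_gibbs[OF x] g_def)
  also have "\<bar>\<dots>\<bar> \<le> measure_pmf.expectation ?\<mu> (\<lambda>y. \<bar>g x - g y\<bar>)"
    by (rule integral_abs_bound)
  also have "\<dots> \<le> measure_pmf.expectation ?\<mu> (\<lambda>y. G)"
  proof (rule integral_mono_AE)
    have "dim_col (B_mat p \<theta> ^\<^sub>m \<tau>) = p"
      using pow_carrier_mat[OF B_mat_carrier] by blast
    then have "\<bar>g x - g y\<bar> \<le> G" if "y \<in> states p" for y
      using osc_le_imp_diff_le[OF sweep_avg_funpow_osc[OF osc] x that]
      by (simp add: g_def G_def entry_sum_col_sum)
    then show "AE y in ?\<mu>. \<bar>g x - g y\<bar> \<le> G"
      by (simp add: AE_measure_pmf_iff set_pmf_markov_net)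
  qed (rule int)+
  finally show ?thesis by (simp add: G_def)
qed

theorem theorem3:
  fixes p \<tau> :: nat and \<theta> :: params and x0 :: state and X :: "state multiset"
  assumes "x0 \<in> states p"
    and "X \<noteq> {#}" and "set_mset X \<subseteq> states p"
  shows "L2_set (\<lambda>e. measure_pmf.expectation (gibbs p \<theta> \<tau> x0) (\<lambda>y. grad_error p X \<theta> y e))
           (stat_idx p)
         \<le> 2 * sqrt (real (card (stat_idx p))) * entry_sum (B_mat p \<theta> ^\<^sub>m \<tau>)"
proof -
  let ?G = "entry_sum (B_mat p \<theta> ^\<^sub>m \<tau>)"
  let ?E = "\<lambda>e. measure_pmf.expectation (gibbs p \<theta> \<tau> x0) (\<lambda>y. grad_error p X \<theta> y e)"
  have bias: "\<bar>?E e\<bar> \<le> ?G" if e: "e \<in> stat_idx p" for e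
  proof -
    have "integrable (gibbs p \<theta> \<tau> x0) (\<lambda>y. suff_stat y e)"
      by (intro integrable_measure_pmf_finite finite_set_pmf_subset_states[OF set_gibbs] assms)
    then have "?E e = measure_pmf.expectation (gibbs p \<theta> \<tau> x0) (\<lambda>y. suff_stat y e)
        - measure_pmf.expectation (markov_net p \<theta>) (\<lambda>y. suff_stat y e)"
      by (simp add: grad_error_eq[OF e])
    then show ?thesis using gibbs_bias[OF assms(1) suff_stat_osc[OF e]] by simp
  qed
  \<comment> \<open>The bias bound for the zero function gives nonnegativity, which allows the
    constant to leave the norm and the factor 2 to be inserted.\<close>
  have G: "0 \<le> ?G"
    using gibbs_bias[OF assms(1), of "\<lambda>_. 0" \<theta> \<tau>] by (simp add: osc_le_def)
  have "L2_set ?E (stat_idx p) = L2_set (\<lambda>e. \<bar>?E e\<bar>) (stat_idx p)"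
    by (simp add: L2_set_def)
  also have "\<dots> \<le> L2_set (\<lambda>e. ?G) (stat_idx p)"
    by (intro L2_set_mono bias) auto
  also have "\<dots> = sqrt (real (card (stat_idx p))) * ?G"
    using G by (simp add: L2_set_constant)
  also have "\<dots> \<le> 2 * sqrt (real (card (stat_idx p))) * ?G"
    using G by simp
  finally show ?thesis .
qed

end
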